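(* The maximum size of an affine cap in $\mathbb{F}_3^n$ is $O(2.84^n)$; that is, there is a constant $K>0$ such that for every positive integer $n$, every affine cap $A\subseteq\mathbb{F}_3^n$ satisfies $|A|\leq K\cdot 2.84^n$.
   Context: $\mathbb{F}_3$ is the field with three elements. An affine cap in $\mathbb{F}_3^n$ is a subset containing no three distinct points on a common affine line; equivalently, it is a progression-free subset of $\mathbb{F}_3^n$, i.e. a subset $A$ with no three pairwise distinct $a,b,c\in A$ satisfying $a+b=2c$. *)

theory Defs
  imports Complex_Main "Jordan_Normal_Form.Matrix"
begin

text \<open>The type \<^typ>\<open>Enum.finite_3\<close> is the distribution's field with three elements. The set
  \<^term>\<open>carrier_vec n\<close> of its vectors of dimension \<open>n\<close> is the space of all
  \<open>n\<close>-tuples, so that \<open>n\<close> can be quantified over.\<close>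

type_synonym f3 = Enum.finite_3

definition affine_line :: "nat \<Rightarrow> f3 vec set \<Rightarrow> bool" where
  "affine_line n L \<longleftrightarrow>
     (\<exists>p\<in>carrier_vec n. \<exists>v\<in>carrier_vec n. v \<noteq> 0\<^sub>v n \<and> L = {p + t \<cdot>\<^sub>v v | t. True})"

definition affine_cap :: "nat \<Rightarrow> f3 vec set \<Rightarrow> bool" where
  "affine_cap n A \<longleftrightarrow> A \<subseteq> carrier_vec n \<and>
     \<not> (\<exists>a\<in>A. \<exists>b\<in>A. \<exists>c\<in>A. a \<noteq> b \<and> a \<noteq> c \<and> b \<noteq> c \<and>
          (\<exists>L. affine_line n L \<and> a \<in> L \<and> b \<in> L \<and> c \<in> L))"

definition progression_free :: "nat \<Rightarrow> f3 vec set \<Rightarrow> bool" where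
  "progression_free n A \<longleftrightarrow> A \<subseteq> carrier_vec n \<and>
     \<not> (\<exists>a\<in>A. \<exists>b\<in>A. \<exists>c\<in>A. a \<noteq> b \<and> a \<noteq> c \<and> b \<noteq> c \<and> a + b = 2 \<cdot>\<^sub>v c)"

lemma card_f3: "card (UNIV :: f3 set) = 3"
  by (simp add: UNIV_finite_3)

lemma f3_double: "2 * y = - (y :: f3)"
  by (cases y; simp add: times_finite_3_def uminus_finite_3_def)

lemma f3_third: "s \<noteq> t \<Longrightarrow> s \<noteq> u \<Longrightarrow> t \<noteq> u \<Longrightarrow> s + t = - (u :: f3)"
  by (cases s; cases t; cases u; simp add: plus_finite_3_def uminus_finite_3_def)

lemma ring_double_identities:
  fixes x y z s t u :: "'a::comm_ring_1"
  assumes "\<And>y::'a. 2 * y = - y"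
  shows "s + t = - u \<Longrightarrow> (x + s * y) + (x + t * y) = 2 * (x + u * y)"
    and "x + y = 2 * z \<Longrightarrow> z = x + (- 1) * (y - x)"
proof -
  have d: "w + w = - w" for w :: 'a using assms[of w] by (simp only: mult_2)
  assume "s + t = - u"
  have "(x + s * y) + (x + t * y) = (x + x) + (s + t) * y" by (simp add: algebra_simps)
  also have "\<dots> = (x + x) + (- u) * y" by (simp only: \<open>s + t = - u\<close>)
  also have "\<dots> = - (x + u * y)" unfolding d[of x] by simp
  finally show "(x + s * y) + (x + t * y) = 2 * (x + u * y)" by (simp only: assms)
next
  have d: "w + w = - w" for w :: 'a using assms[of w] by (simp only: mult_2)
  assume "x + y = 2 * z"
  then have "z = - (x + y)" by (simp only: assms minus_minus)
  also have "\<dots> = - x - y" by simp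
  also have "\<dots> = (x + x) - y" by (simp only: d)
  finally show "z = x + (- 1) * (y - x)" by simp
qed

lemma vec_line_endpoints:
  fixes a b :: "'a::comm_ring_1 vec"
  assumes "a \<in> carrier_vec n" "b \<in> carrier_vec n"
  shows "b - a = 0\<^sub>v n \<Longrightarrow> a = b"
    and "a = a + 0 \<cdot>\<^sub>v (b - a)"
    and "b = a + 1 \<cdot>\<^sub>v (b - a)"
proof -
  assume z: "b - a = 0\<^sub>v n"
  show "a = b"
  proof (rule eq_vecI)
    fix i assume "i < dim_vec b"
    then have i: "i < n" using assms by simp
    have "b $ i - a $ i = (b - a) $ i" using i assms by simp
    also have "\<dots> = 0" using i by (simp add: z)
    finally show "a $ i = b $ i" by simp
  qed (use assms in auto)
qed (use assms in \<open>auto intro!: eq_vecI\<close>)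

lemma finite_carrier_vec_f3: "finite (carrier_vec n :: f3 vec set)"
proof -
  have "carrier_vec n \<subseteq> vec_of_list ` {xs :: f3 list. set xs \<subseteq> UNIV \<and> length xs = n}"
  proof
    fix v :: "f3 vec" assume "v \<in> carrier_vec n"
    then show "v \<in> vec_of_list ` {xs :: f3 list. set xs \<subseteq> UNIV \<and> length xs = n}"
      by (intro image_eqI[of _ _ "list_of_vec v"]) (auto simp: vec_list)
  qed
  moreover have "finite {xs :: f3 list. set xs \<subseteq> UNIV \<and> length xs = n}"
    by (rule finite_lists_length_eq) simp
  ultimately show ?thesis by (metis finite_imageI finite_subset)
qed

lemma f3_collinear_iff:
  assumes a: "a \<in> carrier_vec n" and b: "b \<in> carrier_vec n" and c: "c \<in> carrier_vec n"
    and d: "a \<noteq> b" "a \<noteq> c" "b \<noteq> c"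
  shows "(\<exists>L. affine_line n L \<and> a \<in> L \<and> b \<in> L \<and> c \<in> L) \<longleftrightarrow> a + b = 2 \<cdot>\<^sub>v (c :: f3 vec)"
proof
  assume "\<exists>L. affine_line n L \<and> a \<in> L \<and> b \<in> L \<and> c \<in> L"
  then obtain p v s t u where p: "p \<in> carrier_vec n" and v: "v \<in> carrier_vec n"
    and e: "a = p + s \<cdot>\<^sub>v v" "b = p + t \<cdot>\<^sub>v v" "c = p + u \<cdot>\<^sub>v v"
    unfolding affine_line_def by blast
  have "s \<noteq> t" "s \<noteq> u" "t \<noteq> u" using d e by auto
  then have st: "s + t = - u" by (rule f3_third)
  show "a + b = 2 \<cdot>\<^sub>v c"
  proof (rule eq_vecI)
    fix i assume "i < dim_vec (2 \<cdot>\<^sub>v c)"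
    then have i: "i < n" using c by simp
    show "(a + b) $ i = (2 \<cdot>\<^sub>v c) $ i"
      using ring_double_identities(1)[OF f3_double st, of "p $ i" "v $ i"] i p v
      by (simp only: e index_add_vec index_smult_vec carrier_vecD)
  qed (use a b c in auto)
next
  assume ab: "a + b = 2 \<cdot>\<^sub>v c"
  define L where "L = {a + t \<cdot>\<^sub>v (b - a) | t. True}"
  have "b - a \<noteq> 0\<^sub>v n" using vec_line_endpoints(1)[OF a b] d by blast
  moreover have "b - a \<in> carrier_vec n" using a b by simp
  ultimately have "affine_line n L" using a unfolding affine_line_def L_def by blast
  moreover have "a \<in> L" unfolding L_def using vec_line_endpoints(2)[OF a b] by blast
  moreover have "b \<in> L" unfolding L_def using vec_line_endpoints(3)[OF a b] by blast
  moreover have "c = a + (- 1) \<cdot>\<^sub>v (b - a)"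
  proof (rule eq_vecI)
    fix i assume "i < dim_vec (a + (- 1) \<cdot>\<^sub>v (b - a))"
    then have i: "i < n" using a b by simp
    have "a $ i + b $ i = (a + b) $ i" using i b by (simp only: index_add_vec carrier_vecD)
    also have "\<dots> = 2 * c $ i" unfolding ab using i c by (simp only: index_smult_vec carrier_vecD)
    finally show "c $ i = (a + (- 1) \<cdot>\<^sub>v (b - a)) $ i"
      using ring_double_identities(2)[OF f3_double, of "a $ i" "b $ i" "c $ i"] i a b
      by (simp only: index_add_vec index_smult_vec index_minus_vec carrier_vecD)
  qed (use a b c in auto)
  then have "c \<in> L" unfolding L_def by blast
  ultimately show "\<exists>L. affine_line n L \<and> a \<in> L \<and> b \<in> L \<and> c \<in> L" by blast
qed

lemma affine_cap_iff_progression_free: "affine_cap n A \<longleftrightarrow> progression_free n A"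
proof (cases "A \<subseteq> carrier_vec n")
  case True
  then have *: "(\<exists>L. affine_line n L \<and> a \<in> L \<and> b \<in> L \<and> c \<in> L) \<longleftrightarrow> a + b = 2 \<cdot>\<^sub>v c"
    if "a \<in> A" "b \<in> A" "c \<in> A" "a \<noteq> b" "a \<noteq> c" "b \<noteq> c" for a b c
    using that by (intro f3_collinear_iff) auto
  show ?thesis unfolding affine_cap_def progression_free_def
    by (intro conj_cong arg_cong[of _ _ Not] bex_cong refl *)
qed (auto simp: affine_cap_def progression_free_def)

end

theory Submission
  imports Defs
begin

text \<open>The proof is the slice rank argument of Croot--Lev--Pach, Ellenberg--Gijswijt and Tao. On a
  cap \<open>A\<close> the function \<open>F a b c = (\<Prod>i<n. 1 - (a $ i + b $ i + c $ i)\<^sup>2)\<close> is nonzero exactly on the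
  diagonal. It is a polynomial of degree at most \<open>2 * n\<close>, so each of its monomials has degree at
  most \<open>2 * n / 3\<close> in one of the three vectors; testing \<open>F\<close> against functions orthogonal to those
  low-degree parts shows that \<open>A\<close> has at most three times as many elements as there are exponent
  vectors in \<open>{0, 1, 2}\<^sup>n\<close> of degree at most \<open>2 * n / 3\<close>. These are counted by the exponential
  moment method: weighting degree \<open>d\<close> by \<open>y ^ (3 * d)\<close> bounds their number by
  \<open>((1 + y ^ 3 + y ^ 6) / y\<^sup>2) ^ n\<close>, and \<open>y = 4 / 5\<close> makes the base less than \<open>2.78\<close>.\<close>

section \<open>Linear algebra over a field and the slice rank bound\<close>

text \<open>Fewer homogeneous equations than unknowns: the induction on \<open>I\<close> is Gaussian
  elimination, removing one equation and one unknown at a time. Vanishing outside \<open>S\<close>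
  lets the solution be added to functions on a larger set.\<close>

lemma exists_nonzero_orthogonal:
  fixes g :: "'i \<Rightarrow> 'a \<Rightarrow> 'b::field"
  assumes "finite I" "finite S" "card I < card S"
  shows "\<exists>\<psi>. (\<forall>x. x \<notin> S \<longrightarrow> \<psi> x = 0) \<and> (\<exists>x\<in>S. \<psi> x \<noteq> 0) \<and> (\<forall>i\<in>I. (\<Sum>x\<in>S. \<psi> x * g i x) = 0)"
  using assms
proof (induction I arbitrary: S g rule: finite_induct)
  case empty
  then obtain s where "s \<in> S" by fastforce
  then show ?case by (intro exI[of _ "\<lambda>x. if x = s then 1 else 0"]) auto
next
  case (insert i I)
  show ?case
  proof (cases "\<forall>x\<in>S. g i x = 0")
    case True
    then have "(\<Sum>x\<in>S. \<psi> x * g i x) = 0" for \<psi> by simp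
    moreover have "card I < card S" using insert by simp
    ultimately show ?thesis using insert.IH[OF insert.prems(1), of g] by (metis insert_iff)
  next
    case False
    then obtain s where s: "s \<in> S" "g i s \<noteq> 0" by blast
    define S' where "S' = S - {s}"
    \<comment> \<open>Subtracting the multiple of equation \<open>i\<close> that makes
      \<open>g' j s = 0\<close> eliminates the unknown at the pivot \<open>s\<close>; the value of
      \<open>\<psi>\<close> at \<open>s\<close> is later chosen to solve equation
      \<open>i\<close>.\<close>
    define g' where "g' = (\<lambda>j x. g j x - g j s / g i s * g i x)"
    have S': "finite S'" "s \<notin> S'" "S = insert s S'" using s insert.prems by (auto simp: S'_def)
    moreover have "card I < card S'" using insert S' by simp
    ultimately obtain \<psi>' where \<psi>': "\<And>x. x \<notin> S' \<Longrightarrow> \<psi>' x = 0" "\<exists>x\<in>S'. \<psi>' x \<noteq> 0"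
      "\<And>j. j \<in> I \<Longrightarrow> (\<Sum>x\<in>S'. \<psi>' x * g' j x) = 0"
      using insert.IH[of S' g'] by blast
    define w where "w = (\<Sum>x\<in>S'. \<psi>' x * g i x)"
    define \<psi> where "\<psi> = \<psi>'(s := - w / g i s)"
    have sum: "(\<Sum>x\<in>S. \<psi> x * g j x) = - w / g i s * g j s + (\<Sum>x\<in>S'. \<psi>' x * g j x)" for j
      using S' by (auto simp: \<psi>_def intro!: sum.cong)
    have "(\<Sum>x\<in>S. \<psi> x * g j x) = 0" if "j \<in> I" for j
    proof -
      have "(\<Sum>x\<in>S'. \<psi>' x * g' j x) = (\<Sum>x\<in>S'. \<psi>' x * g j x) - g j s / g i s * w"
        by (simp add: g'_def w_def right_diff_distrib sum_subtractf sum_distrib_left mult_ac)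
      then show ?thesis using \<psi>'(3)[OF that] by (simp add: sum mult_ac)
    qed
    moreover have "(\<Sum>x\<in>S. \<psi> x * g i x) = 0" using s by (simp add: sum w_def)
    moreover have "\<forall>x. x \<notin> S \<longrightarrow> \<psi> x = 0" using \<psi>'(1) S' by (auto simp: \<psi>_def)
    moreover have "\<exists>x\<in>S. \<psi> x \<noteq> 0" using \<psi>'(2) S' by (auto simp: \<psi>_def)
    ultimately show ?thesis by (intro exI[of _ \<psi>]) auto
  qed
qed

text \<open>An orthogonal function of maximal support works: if it had more than
  \<open>card I\<close> zeros in \<open>A\<close>, a nonzero orthogonal function living on those
  zeros could be added, enlarging the support.\<close>

lemma exists_orthogonal_large_support:
  fixes g :: "'i \<Rightarrow> 'a \<Rightarrow> 'b::field"
  assumes "finite I" "finite A"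
  shows "\<exists>\<phi>. (\<forall>i\<in>I. (\<Sum>x\<in>A. \<phi> x * g i x) = 0) \<and> card A \<le> card {x\<in>A. \<phi> x \<noteq> 0} + card I"
proof -
  define P where "P = (\<lambda>\<phi>::'a \<Rightarrow> 'b. \<forall>i\<in>I. (\<Sum>x\<in>A. \<phi> x * g i x) = 0)"
  define supp where "supp = (\<lambda>\<phi>::'a \<Rightarrow> 'b. {x\<in>A. \<phi> x \<noteq> 0})"
  have "P (\<lambda>_. 0)" by (simp add: P_def)
  moreover have "\<forall>\<phi>. P \<phi> \<longrightarrow> card (supp \<phi>) < Suc (card A)"
    using assms by (auto simp: supp_def less_Suc_eq_le intro: card_mono)
  ultimately have "\<exists>\<phi>. P \<phi> \<and> (\<forall>\<phi>'. P \<phi>' \<longrightarrow> card (supp \<phi>') \<le> card (supp \<phi>))"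
    by (rule ex_has_greatest_nat)
  then obtain \<phi> where \<phi>: "P \<phi>" and max: "\<And>\<phi>'. P \<phi>' \<Longrightarrow> card (supp \<phi>') \<le> card (supp \<phi>)" by blast
  have "card A \<le> card (supp \<phi>) + card I"
  proof (rule ccontr)
    assume "\<not> ?thesis"
    then have "card I < card (A - supp \<phi>)"
      using assms by (subst card_Diff_subset) (auto simp: supp_def)
    then obtain \<psi> where \<psi>: "\<And>x. x \<notin> A - supp \<phi> \<Longrightarrow> \<psi> x = 0" "\<exists>x\<in>A - supp \<phi>. \<psi> x \<noteq> 0"
      "\<And>i. i \<in> I \<Longrightarrow> (\<Sum>x\<in>A - supp \<phi>. \<psi> x * g i x) = 0"
      using exists_nonzero_orthogonal[of I "A - supp \<phi>" g] assms by auto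
    have "(\<Sum>x\<in>A. \<psi> x * g i x) = (\<Sum>x\<in>A - supp \<phi>. \<psi> x * g i x)" for i
      using assms \<psi>(1) by (intro sum.mono_neutral_right) auto
    then have "P (\<lambda>x. \<phi> x + \<psi> x)"
      using \<phi> \<psi>(3) by (simp add: P_def distrib_right sum.distrib)
    moreover have "supp \<phi> \<subset> supp (\<lambda>x. \<phi> x + \<psi> x)"
      using \<psi>(1,2) by (fastforce simp: supp_def)
    then have "card (supp \<phi>) < card (supp (\<lambda>x. \<phi> x + \<psi> x))"
      using assms by (intro psubset_card_mono) (auto simp: supp_def)
    ultimately show False using max by fastforce
  qed
  then show ?thesis using \<phi> unfolding P_def supp_def by blast
qed

text \<open>The lower bound on the slice rank of a diagonal tensor. The sets \<open>I\<close>, \<open>J\<close>, \<open>K\<close> index the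
  slices in the three directions; a term indexed by \<open>e\<close> belongs to a slice as soon as one of its
  three factors does.\<close>

lemma card_le_slices_of_diagonal:
  fixes F :: "'a \<Rightarrow> 'a \<Rightarrow> 'a \<Rightarrow> 'b::field"
  assumes fin: "finite A" "finite E" "finite I" "finite J" "finite K"
    and diag: "\<And>a b c. a \<in> A \<Longrightarrow> b \<in> A \<Longrightarrow> c \<in> A \<Longrightarrow> F a b c \<noteq> 0 \<longleftrightarrow> a = b \<and> b = c"
    and F: "\<And>a b c. F a b c = (\<Sum>e\<in>E. k e * \<alpha> (p e) a * \<beta> (q e) b * \<gamma> (r e) c)"
    and slices: "\<And>e. e \<in> E \<Longrightarrow> p e \<in> I \<or> q e \<in> J \<or> r e \<in> K"
  shows "card A \<le> card I + card J + card K"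
proof -
  obtain \<phi> where \<phi>: "\<And>i. i \<in> I \<Longrightarrow> (\<Sum>a\<in>A. \<phi> a * \<alpha> i a) = 0"
    and "card A \<le> card {x\<in>A. \<phi> x \<noteq> 0} + card I"
    using exists_orthogonal_large_support[OF fin(3,1), of \<alpha>] by blast
  moreover define S where "S = {x\<in>A. \<phi> x \<noteq> 0}"
  moreover have "card S \<le> card J + card K"
  proof (rule ccontr)
    assume "\<not> ?thesis"
    \<comment> \<open>The disjoint sum keeps the two families of conditions apart, since
      \<open>J\<close> and \<open>K\<close> may share indices.\<close>
    then have lt: "card (J <+> K) < card S" using fin by (simp add: card_Plus)
    \<comment> \<open>Contracting the first variable with \<open>\<phi>\<close> turns the
      coefficient \<open>k e\<close> into \<open>m e\<close>, which is 0 when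
      \<open>p e \<in> I\<close>. Orthogonality of \<open>\<psi>\<close> to \<open>J\<close> will
      kill the terms with \<open>q e \<in> J\<close>, leaving only \<open>E'\<close>.\<close>
    define m where "m = (\<lambda>e. k e * (\<Sum>a\<in>A. \<phi> a * \<alpha> (p e) a))"
    define E' where "E' = {e\<in>E. q e \<notin> J \<and> r e \<in> K}"
    \<comment> \<open>All remaining terms with third index \<open>l\<close> are merged, so that each
      \<open>l \<in> K\<close> costs a single condition on \<open>\<psi>\<close>.\<close>
    define h where "h = (\<lambda>l b. \<Sum>e | e \<in> E' \<and> r e = l. m e * \<beta> (q e) b)"
    have S: "finite S" "S \<subseteq> A" using fin by (auto simp: S_def)
    obtain \<psi> where \<psi>: "\<exists>x\<in>S. \<psi> x \<noteq> 0"
      and \<psi>_orth: "\<And>i. i \<in> J <+> K \<Longrightarrow> (\<Sum>b\<in>S. \<psi> b * case_sum \<beta> h i b) = 0"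
      using exists_nonzero_orthogonal[OF _ S(1) lt, of "case_sum \<beta> h"] fin by auto
    have \<psi>J: "(\<Sum>b\<in>S. \<psi> b * \<beta> j b) = 0" if "j \<in> J" for j
      using \<psi>_orth[of "Inl j"] that by auto
    have \<psi>K: "(\<Sum>b\<in>S. \<psi> b * h l b) = 0" if "l \<in> K" for l
      using \<psi>_orth[of "Inr l"] that by auto
    from \<psi> obtain c where c: "c \<in> S" "\<psi> c \<noteq> 0" by blast
    define t where "t = (\<lambda>e. \<Sum>b\<in>S. \<psi> b * (m e * \<beta> (q e) b))"
    have t: "t e = m e * (\<Sum>b\<in>S. \<psi> b * \<beta> (q e) b)" for e
      by (simp add: t_def sum_distrib_left mult_ac)
    have t0: "t e = 0" if "e \<in> E - E'" for e
      using that slices[of e] \<psi>J[of "q e"] \<phi>[of "p e"] by (auto simp: t E'_def m_def)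
    have F0: "F a b c = 0" if "a \<in> A" "b \<in> A" "\<not> (a = b \<and> b = c)" for a b
      using diag[of a b c] that c S by blast
    \<comment> \<open>This contraction is computed twice: the slices give 0, while the diagonal
      gives \<open>\<psi> c * (\<phi> c * F c c c)\<close>, which is nonzero.\<close>
    have "(\<Sum>b\<in>S. \<psi> b * (\<Sum>a\<in>A. \<phi> a * F a b c))
        = (\<Sum>b\<in>S. \<psi> b * (\<Sum>e\<in>E. m e * \<beta> (q e) b * \<gamma> (r e) c))"
    proof (intro sum.cong refl arg_cong2[where f = times])
      fix b
      have "(\<Sum>a\<in>A. \<phi> a * F a b c)
          = (\<Sum>a\<in>A. \<Sum>e\<in>E. k e * (\<phi> a * \<alpha> (p e) a) * \<beta> (q e) b * \<gamma> (r e) c)"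
        by (simp add: F sum_distrib_left mult_ac)
      also have "\<dots> = (\<Sum>e\<in>E. \<Sum>a\<in>A. k e * (\<phi> a * \<alpha> (p e) a) * \<beta> (q e) b * \<gamma> (r e) c)"
        by (rule sum.swap)
      finally show "(\<Sum>a\<in>A. \<phi> a * F a b c) = (\<Sum>e\<in>E. m e * \<beta> (q e) b * \<gamma> (r e) c)"
        by (simp add: m_def sum_distrib_left sum_distrib_right)
    qed
    also have "\<dots> = (\<Sum>b\<in>S. \<Sum>e\<in>E. \<psi> b * (m e * \<beta> (q e) b) * \<gamma> (r e) c)"
      by (simp add: sum_distrib_left mult_ac)
    also have "\<dots> = (\<Sum>e\<in>E. \<Sum>b\<in>S. \<psi> b * (m e * \<beta> (q e) b) * \<gamma> (r e) c)"
      by (rule sum.swap)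
    also have "\<dots> = (\<Sum>e\<in>E. t e * \<gamma> (r e) c)" by (simp add: t_def sum_distrib_right)
    also have "\<dots> = (\<Sum>e\<in>E'. t e * \<gamma> (r e) c)"
      using fin t0 by (intro sum.mono_neutral_right) (auto simp: E'_def)
    also have "\<dots> = (\<Sum>l\<in>K. \<Sum>e | e \<in> E' \<and> r e = l. t e * \<gamma> (r e) c)"
      using fin by (intro sum.group[symmetric]) (auto simp: E'_def)
    also have "\<dots> = (\<Sum>l\<in>K. (\<Sum>b\<in>S. \<psi> b * h l b) * \<gamma> l c)"
    proof (intro sum.cong refl)
      fix l
      have "(\<Sum>e | e \<in> E' \<and> r e = l. t e * \<gamma> (r e) c) = (\<Sum>e | e \<in> E' \<and> r e = l. t e) * \<gamma> l c"
        by (simp add: sum_distrib_right)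
      also have "(\<Sum>e | e \<in> E' \<and> r e = l. t e) = (\<Sum>b\<in>S. \<psi> b * h l b)"
        unfolding t_def h_def sum_distrib_left by (rule sum.swap)
      finally show "(\<Sum>e | e \<in> E' \<and> r e = l. t e * \<gamma> (r e) c) = (\<Sum>b\<in>S. \<psi> b * h l b) * \<gamma> l c" .
    qed
    also have "\<dots> = 0" by (simp add: \<psi>K)
    finally have "(\<Sum>b\<in>S. \<psi> b * (\<Sum>a\<in>A. \<phi> a * F a b c)) = 0" .
    moreover have "(\<Sum>b\<in>S. \<psi> b * (\<Sum>a\<in>A. \<phi> a * F a b c))
        = (\<Sum>b\<in>S. if b = c then \<psi> c * (\<phi> c * F c c c) else 0)"
    proof (intro sum.cong refl)
      fix b assume b: "b \<in> S"
      have "(\<Sum>a\<in>A. \<phi> a * F a b c) = (\<Sum>a\<in>A. if a = c then (if b = c then \<phi> c * F c c c else 0) else 0)"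
        using F0 b S by (intro sum.cong) auto
      then show "\<psi> b * (\<Sum>a\<in>A. \<phi> a * F a b c) = (if b = c then \<psi> c * (\<phi> c * F c c c) else 0)"
        using fin c S by auto
    qed
    ultimately have "\<psi> c * (\<phi> c * F c c c) = 0" using c S by simp
    then show False using c diag[of c c c] by (auto simp: S_def)
  qed
  ultimately show ?thesis by simp
qed

section \<open>Counting low-degree exponent vectors\<close>

text \<open>As \<open>y \<le> 1\<close>, each counted vector has weight at least
  \<open>y ^ (2 * n)\<close>; the total weight of all exponent vectors factors over the
  coordinates.\<close>

lemma card_low_degree_exponents:
  fixes y :: real
  assumes y: "0 < y" "y \<le> 1"
  shows "real (card {p \<in> {..<n} \<rightarrow>\<^sub>E {..2::nat}. 3 * (\<Sum>i<n. p i) \<le> 2 * n})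
    \<le> ((1 + y ^ 3 + y ^ 6) / y\<^sup>2) ^ n" (is "real (card ?D) \<le> _")
proof -
  have fin: "finite ({..<n} \<rightarrow>\<^sub>E {..2::nat})" by (intro finite_PiE) auto
  have "real (card ?D) * y ^ (2 * n) = (\<Sum>p\<in>?D. y ^ (2 * n))" by simp
  also have "\<dots> \<le> (\<Sum>p\<in>?D. y ^ (3 * (\<Sum>i<n. p i)))"
    using y by (intro sum_mono power_decreasing) auto
  also have "\<dots> \<le> (\<Sum>p\<in>{..<n} \<rightarrow>\<^sub>E {..2}. y ^ (3 * (\<Sum>i<n. p i)))"
    using fin y by (intro sum_mono2) auto
  also have "\<dots> = (\<Sum>p\<in>{..<n} \<rightarrow>\<^sub>E {..2}. \<Prod>i<n. y ^ (3 * p i))"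
    by (simp add: sum_distrib_left power_sum)
  also have "\<dots> = (\<Prod>i<n. \<Sum>d\<le>2. y ^ (3 * d))"
    by (rule prod_sum_PiE[symmetric]) auto
  also have "\<dots> = (1 + y ^ 3 + y ^ 6) ^ n" by (simp add: eval_nat_numeral)
  finally show ?thesis using y by (simp add: power_divide power_mult pos_le_divide_eq)
qed

section \<open>The polynomial detecting the diagonal\<close>

lemma f3_square: "x \<noteq> 0 \<Longrightarrow> x\<^sup>2 = (1 :: f3)"
  by (cases x; simp add: power2_eq_square times_finite_3_def zero_finite_3_def one_finite_3_def)

definition square_factor_exponents :: "(nat \<times> nat \<times> nat) set" where
  "square_factor_exponents = {(0,0,0), (2,0,0), (0,2,0), (0,0,2), (1,1,0), (1,0,1), (0,1,1)}"

text \<open>Among the nonconstant triples, an entry 2 marks a pure square; the others are mixed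
  products, hence \<open>- 2\<close>.\<close>

definition square_factor_coeff :: "nat \<times> nat \<times> nat \<Rightarrow> 'a::comm_ring_1" where
  "square_factor_coeff = (\<lambda>(p, q, r). if p + q + r = 0 then 1 else if p = 2 \<or> q = 2 \<or> r = 2 then - 1 else - 2)"

lemma square_factor_expansion:
  fixes x y z :: "'a::comm_ring_1"
  shows "1 - (x + y + z)\<^sup>2 =
    (\<Sum>(p, q, r)\<in>square_factor_exponents. square_factor_coeff (p, q, r) * x ^ p * y ^ q * z ^ r)"
  unfolding square_factor_exponents_def square_factor_coeff_def
  by (simp add: power2_eq_square algebra_simps)

text \<open>Multiplying out chooses one monomial per coordinate. The use of \<open>restrict\<close>
  makes the exponent vectors extensional, so that they can lie in a finite \<open>PiE\<close>
  set.\<close>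

lemma vec_product_expansion:
  fixes a b c :: "'a::comm_ring_1 vec"
  shows "(\<Prod>i<n. 1 - (a $ i + b $ i + c $ i)\<^sup>2) =
    (\<Sum>e\<in>{..<n} \<rightarrow>\<^sub>E square_factor_exponents. (\<Prod>i<n. square_factor_coeff (e i)) *
      (\<Prod>i<n. a $ i ^ restrict (fst \<circ> e) {..<n} i) *
      (\<Prod>i<n. b $ i ^ restrict (fst \<circ> snd \<circ> e) {..<n} i) *
      (\<Prod>i<n. c $ i ^ restrict (snd \<circ> snd \<circ> e) {..<n} i))"
proof -
  have "(\<Prod>i<n. 1 - (a $ i + b $ i + c $ i)\<^sup>2) =
      (\<Prod>i<n. \<Sum>t\<in>square_factor_exponents.
        square_factor_coeff t * a $ i ^ fst t * b $ i ^ fst (snd t) * c $ i ^ snd (snd t))"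
    by (simp add: square_factor_expansion case_prod_beta)
  also have "\<dots> = (\<Sum>e\<in>{..<n} \<rightarrow>\<^sub>E square_factor_exponents. \<Prod>i<n.
        square_factor_coeff (e i) * a $ i ^ fst (e i) * b $ i ^ fst (snd (e i)) * c $ i ^ snd (snd (e i)))"
    by (intro prod_sum_PiE) (auto simp: square_factor_exponents_def)
  finally show ?thesis by (simp add: prod.distrib)
qed

text \<open>Over \<open>f3\<close>, \<open>1 - x\<^sup>2\<close> is the indicator of
  \<open>x = 0\<close> and \<open>2 = - 1\<close>, so the product is nonzero exactly when
  \<open>a + b = 2 \<cdot>\<^sub>v c\<close>. Then two of the points coincide, and the equation
  forces the third to equal them.\<close>

lemma progression_free_diagonal:
  assumes A: "progression_free n A" and abc: "a \<in> A" "b \<in> A" "c \<in> A"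
  shows "(\<Prod>i<n. 1 - (a $ i + b $ i + c $ i)\<^sup>2) \<noteq> 0 \<longleftrightarrow> a = b \<and> b = c"
proof -
  have dim: "dim_vec a = n" "dim_vec b = n" "dim_vec c = n"
    using A abc by (auto simp: progression_free_def)
  have same: "x + x + y = 0 \<longleftrightarrow> x = y" for x y :: f3
    by (auto simp only: mult_2[symmetric] f3_double add_eq_0_iff minus_minus)
  have same_vec: "u = v" if "\<And>i. i < n \<Longrightarrow> u $ i + u $ i + v $ i = 0" "dim_vec u = n" "dim_vec v = n"
    for u v :: "f3 vec"
    using that by (intro eq_vecI) (auto simp only: same)
  define s where "s = (\<lambda>i. a $ i + b $ i + c $ i)"
  have "1 - x\<^sup>2 = 0 \<longleftrightarrow> x \<noteq> 0" for x :: f3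
    using f3_square[of x] by (metis diff_self diff_zero zero_neq_one zero_power2)
  then have "(\<Prod>i<n. 1 - (s i)\<^sup>2) \<noteq> 0 \<longleftrightarrow> (\<forall>i<n. s i = 0)"
    by (simp only: prod_zero_iff finite_lessThan) blast
  also have "\<dots> \<longleftrightarrow> a = b \<and> b = c"
  proof
    assume "\<forall>i<n. s i = 0"
    then have z: "a $ i + b $ i + c $ i = 0" if "i < n" for i using that by (simp only: s_def)
    have "a + b = 2 \<cdot>\<^sub>v c"
    proof (rule eq_vecI)
      fix i assume "i < dim_vec (2 \<cdot>\<^sub>v c)"
      then have i: "i < n" using dim by simp
      then have "a $ i + b $ i = - c $ i" using z by (simp only: eq_neg_iff_add_eq_0)
      then show "(a + b) $ i = (2 \<cdot>\<^sub>v c) $ i"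
        using i dim by (simp only: index_add_vec index_smult_vec f3_double)
    qed (use dim in simp)
    then have "a = b \<or> a = c \<or> b = c" using A abc unfolding progression_free_def by blast
    moreover have "b = c" if "a = b"
      using z dim that by (intro same_vec) auto
    moreover have "a = b" if "a = c"
      using z dim that by (intro same_vec) (auto simp only: add_ac)
    moreover have "b = a" if "b = c"
      using z dim that by (intro same_vec) (auto simp only: add_ac)
    ultimately show "a = b \<and> b = c" by blast
  next
    assume "a = b \<and> b = c"
    then show "\<forall>i<n. s i = 0" using same by (auto simp only: s_def)
  qed
  finally show ?thesis by (simp only: s_def)
qed

section \<open>The bound for caps\<close>

text \<open>The three exponent vectors of a monomial have total degree at most \<open>2 * n\<close>,
  so by pigeonhole one lies in \<open>D\<close>, which therefore indexes the slices in all three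
  directions.\<close>

lemma card_progression_free_le:
  assumes A: "progression_free n A"
  shows "card A \<le> 3 * card {p \<in> {..<n} \<rightarrow>\<^sub>E {..2::nat}. 3 * (\<Sum>i<n. p i) \<le> 2 * n}"
proof -
  define D where "D = {p \<in> {..<n} \<rightarrow>\<^sub>E {..2::nat}. 3 * (\<Sum>i<n. p i) \<le> 2 * n}"
  define E where "E = {..<n} \<rightarrow>\<^sub>E square_factor_exponents"
  have "card A \<le> card D + card D + card D"
  proof (rule card_le_slices_of_diagonal[where A = A and E = E and I = D and J = D and K = D
        and F = "\<lambda>a b c. \<Prod>i<n. 1 - (a $ i + b $ i + c $ i)\<^sup>2"
        and k = "\<lambda>e. \<Prod>i<n. square_factor_coeff (e i)"
        and \<alpha> = "\<lambda>u a. \<Prod>i<n. a $ i ^ u i" and \<beta> = "\<lambda>u b. \<Prod>i<n. b $ i ^ u i"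
        and \<gamma> = "\<lambda>u c. \<Prod>i<n. c $ i ^ u i"
        and p = "\<lambda>e. restrict (fst \<circ> e) {..<n}" and q = "\<lambda>e. restrict (fst \<circ> snd \<circ> e) {..<n}"
        and r = "\<lambda>e. restrict (snd \<circ> snd \<circ> e) {..<n}",
        OF _ _ _ _ _ progression_free_diagonal[OF A] vec_product_expansion[where n = n, folded E_def]])
    show "finite A"
      using A finite_carrier_vec_f3 by (auto simp: progression_free_def intro: finite_subset)
    show "finite E" unfolding E_def by (intro finite_PiE) (auto simp: square_factor_exponents_def)
    have "finite ({..<n} \<rightarrow>\<^sub>E {..2::nat})" by (intro finite_PiE) auto
    then show "finite D" "finite D" "finite D" unfolding D_def by auto
    fix e assume "e \<in> E"
    then have e: "e i \<in> square_factor_exponents" if "i < n" for i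
      using that by (auto simp: E_def)
    have le: "fst (e i) \<le> 2" "fst (snd (e i)) \<le> 2" "snd (snd (e i)) \<le> 2"
      "fst (e i) + fst (snd (e i)) + snd (snd (e i)) \<le> 2" if "i < n" for i
      using e[OF that] by (auto simp: square_factor_exponents_def)
    have "(\<Sum>i<n. fst (e i) + fst (snd (e i)) + snd (snd (e i))) \<le> (\<Sum>i<n. 2)"
      using le by (intro sum_mono) auto
    then have "(\<Sum>i<n. fst (e i)) + (\<Sum>i<n. fst (snd (e i))) + (\<Sum>i<n. snd (snd (e i))) \<le> 2 * n"
      by (simp add: sum.distrib)
    then have "3 * (\<Sum>i<n. fst (e i)) \<le> 2 * n \<or> 3 * (\<Sum>i<n. fst (snd (e i))) \<le> 2 * n
        \<or> 3 * (\<Sum>i<n. snd (snd (e i))) \<le> 2 * n" by linarith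
    then show "restrict (fst \<circ> e) {..<n} \<in> D \<or> restrict (fst \<circ> snd \<circ> e) {..<n} \<in> D
        \<or> restrict (snd \<circ> snd \<circ> e) {..<n} \<in> D"
      using le by (auto simp: D_def)
  qed
  then show ?thesis by (simp add: D_def)
qed

theorem corollary1:
  shows "\<exists>K::real. K > 0 \<and>
    (\<forall>n::nat. n \<ge> 1 \<longrightarrow>
      (\<forall>A. affine_cap n A \<longrightarrow> real (card A) \<le> K * 2.84 ^ n))"
proof (intro exI[of _ 3] conjI allI impI)
  fix n :: nat and A assume "affine_cap n A"
  define N where "N = card {p \<in> {..<n} \<rightarrow>\<^sub>E {..2::nat}. 3 * (\<Sum>i<n. p i) \<le> 2 * n}"
  have "card A \<le> 3 * N"
    using card_progression_free_le \<open>affine_cap n A\<close>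
    unfolding N_def affine_cap_iff_progression_free by blast
  then have "real (card A) \<le> 3 * real N" by linarith
  \<comment> \<open>The base is minimal, about 2.755, near \<open>y = 0.84\<close>; the simple
    fraction \<open>4/5\<close> gives about 2.772, still below 2.84.\<close>
  also have "real N \<le> ((1 + (4/5) ^ 3 + (4/5) ^ 6) / (4/5)\<^sup>2) ^ n"
    unfolding N_def by (rule card_low_degree_exponents) auto
  also have "\<dots> \<le> 2.84 ^ n" by (intro power_mono) (auto simp: power_divide)
  finally show "real (card A) \<le> 3 * 2.84 ^ n" by simp
qed simp

end
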